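(* The subequation $\mathcal P(\mathrm{LAG})$ is exactly the closed Gårding cone of $\mathrm M_{\mathrm{Lag}}$, i.e. the set of $A\in\mathrm{Sym}^2_{\mathbb R}(\mathbb C^n)$ defined by the inequalities $\Lambda_{\pm\pm\cdots\pm}(A)\ge0$ for all $2^n$ choices of signs.
   Context: $\mathrm{Sym}^2_{\mathbb R}(\mathbb C^n)$ is the space of real symmetric endomorphisms (equivalently, real quadratic forms) of $\mathbb C^n=(\mathbb R^{2n},J,\langle\cdot,\cdot\rangle)$. A real $n$-plane $W\subset\mathbb C^n$ is Lagrangian if $JW=W^\perp$; $\mathrm{LAG}$ is the set of these. $\mathcal P(\mathrm{LAG})=\{A\in\mathrm{Sym}^2_{\mathbb R}(\mathbb C^n):\mathrm{tr}(A|_W)\ge0\ \forall\,W\in\mathrm{LAG}\}$, where $A|_W$ is the restriction of the quadratic form to $W$. For $A\in \mathrm{Sym}^2_{\mathbb R}(\mathbb C^n)$ let $\mu=\frac12\mathrm{tr}A$ and let $A^{\mathrm{skew}}=\frac12(A+JAJ)$, whose $2n$ eigenvalues are $\pm\lambda_1,\dots,\pm\lambda_n$, with $\lambda_j\ge0$. Put $\Lambda_{\pm\pm\cdots\pm}(A)=\mu\pm\lambda_1\pm\cdots\pm\lambda_n$ and $\mathrm M_{\mathrm{Lag}}(A)=\prod_\pm\Lambda_{\pm\pm\cdots\pm}(A)$ (product over all $2^n$ sign choices). This is a polynomial on $\mathrm{Sym}^2_{\mathbb R}(\mathbb C^n)$, hyperbolic in the direction $\frac1nI$, with Gårding eigenvalues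 (negatives of the roots in $t$ of $\mathrm M_{\mathrm{Lag}}(\frac tnI+A)$) equal to the $\Lambda_{\pm\cdots\pm}(A)$. Its closed Gårding cone is the set where all Gårding eigenvalues are $\ge0$ (equivalently, the closure of the connected component of $\{\mathrm M_{\mathrm{Lag}}\ne0\}$ containing $I$). *)

theory Defs
  imports "HOL-Analysis.Analysis"
begin

(* C^n is the Euclidean space complex^'n: all linear-algebra notions below (blinfun, inner
   product, subspace, span, dim) are over the reals. *)

section \<open>Traces of quadratic forms on subspaces\<close>

definition orthonormal_basis_of :: "'a::euclidean_space set \<Rightarrow> 'a set \<Rightarrow> bool" where
  "orthonormal_basis_of B W \<longleftrightarrow>
     pairwise orthogonal B \<and> (\<forall>b\<in>B. norm b = 1) \<and> span B = W"

(* The choice of orthonormal basis is immaterial, see trace_on_eq. *)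
definition trace_on :: "'a::euclidean_space \<Rightarrow>\<^sub>L 'a \<Rightarrow> 'a set \<Rightarrow> real" where
  "trace_on A W = (\<Sum>b\<in>(SOME B. orthonormal_basis_of B W). blinfun_apply A b \<bullet> b)"

lemma orthonormal_basis_of_finite:
  assumes "orthonormal_basis_of B W"
  shows "finite B" "independent B"
proof -
  show "independent B"
    using assms unfolding orthonormal_basis_of_def
    by (intro pairwise_orthogonal_independent) auto
  then show "finite B" by (rule independent_imp_finite)
qed

lemma orthonormal_basis_of_expand:
  assumes B: "orthonormal_basis_of B W" and x: "x \<in> W"
  shows "x = (\<Sum>b\<in>B. (x \<bullet> b) *\<^sub>R b)"
proof -
  have fin: "finite B" using orthonormal_basis_of_finite[OF B] by simp
  from x B obtain u where u: "x = (\<Sum>b\<in>B. u b *\<^sub>R b)"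
    unfolding orthonormal_basis_of_def using span_finite[OF fin] by auto
  have "x \<bullet> c = u c" if c: "c \<in> B" for c
  proof -
    have "x \<bullet> c = (\<Sum>b\<in>B. u b * (b \<bullet> c))"
      unfolding u by (simp add: inner_sum_left)
    also have "\<dots> = (\<Sum>b\<in>B. if b = c then u c else 0)"
    proof (rule sum.cong)
      fix b assume b: "b \<in> B"
      show "u b * (b \<bullet> c) = (if b = c then u c else 0)"
      proof (cases "b = c")
        case True
        then show ?thesis using B c
          by (simp add: orthonormal_basis_of_def dot_square_norm)
      next
        case False
        then have "b \<bullet> c = 0" using B b c
          unfolding orthonormal_basis_of_def pairwise_def orthogonal_def by blast
        then show ?thesis using False by simp
      qed
    qed simp
    also have "\<dots> = u c" using fin c by simp
    finally show ?thesis .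
  qed
  then have "(\<Sum>b\<in>B. (x \<bullet> b) *\<^sub>R b) = (\<Sum>b\<in>B. u b *\<^sub>R b)" by (intro sum.cong) auto
  then show ?thesis using u by simp
qed

lemma trace_orthonormal_basis_unique:
  assumes B: "orthonormal_basis_of B W" and C: "orthonormal_basis_of C W"
  shows "(\<Sum>b\<in>B. blinfun_apply A b \<bullet> b) = (\<Sum>c\<in>C. blinfun_apply A c \<bullet> c)"
proof -
  have BW: "b \<in> W" if "b \<in> B" for b
    using B that by (auto simp: orthonormal_basis_of_def intro: span_base)
  have CW: "c \<in> W" if "c \<in> C" for c
    using C that by (auto simp: orthonormal_basis_of_def intro: span_base)
  have WW: "A b \<bullet> b = (\<Sum>c\<in>C. (b \<bullet> c) * (A c \<bullet> b))" if "b \<in> B" for b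
  proof -
    have "A b \<bullet> b = A (\<Sum>c\<in>C. (b \<bullet> c) *\<^sub>R c) \<bullet> b"
      using orthonormal_basis_of_expand[OF C BW[OF that]] by simp
    also have "\<dots> = (\<Sum>c\<in>C. (b \<bullet> c) * (A c \<bullet> b))"
      by (simp add: blinfun.sum_right blinfun.scaleR_right inner_sum_left)
    finally show ?thesis .
  qed
  have VV: "(\<Sum>b\<in>B. (b \<bullet> c) * (A c \<bullet> b)) = A c \<bullet> c" if "c \<in> C" for c
  proof -
    have "A c \<bullet> c = A c \<bullet> (\<Sum>b\<in>B. (c \<bullet> b) *\<^sub>R b)"
      using orthonormal_basis_of_expand[OF B CW[OF that]] by simp
    also have "\<dots> = (\<Sum>b\<in>B. (b \<bullet> c) * (A c \<bullet> b))"
      by (simp add: inner_sum_right inner_commute)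
    finally show ?thesis by simp
  qed
  have "(\<Sum>b\<in>B. A b \<bullet> b) = (\<Sum>b\<in>B. \<Sum>c\<in>C. (b \<bullet> c) * (A c \<bullet> b))"
    using WW by (intro sum.cong) auto
  also have "\<dots> = (\<Sum>c\<in>C. \<Sum>b\<in>B. (b \<bullet> c) * (A c \<bullet> b))" by (rule sum.swap)
  also have "\<dots> = (\<Sum>c\<in>C. A c \<bullet> c)" using VV by (intro sum.cong) auto
  finally show ?thesis .
qed

lemma trace_on_eq:
  assumes "orthonormal_basis_of B W"
  shows "trace_on A W = (\<Sum>b\<in>B. blinfun_apply A b \<bullet> b)"
  unfolding trace_on_def
  by (rule trace_orthonormal_basis_unique[OF someI[of "\<lambda>B. orthonormal_basis_of B W", OF assms] assms])

lemma orthonormal_basis_of_exists: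
  assumes "subspace W"
  obtains B where "orthonormal_basis_of B W"
  using orthonormal_basis_subspace[OF assms] unfolding orthonormal_basis_of_def by metis

lemma orthonormal_basis_of_Basis: "orthonormal_basis_of Basis UNIV"
  unfolding orthonormal_basis_of_def pairwise_def orthogonal_def
  by (auto simp: inner_not_same_Basis)

lemma trace_on_UNIV: "trace_on A UNIV = (\<Sum>b\<in>Basis. blinfun_apply A b \<bullet> b)"
  by (rule trace_on_eq[OF orthonormal_basis_of_Basis])


section \<open>Lagrangian planes\<close>

lift_definition J :: "(complex ^ 'n) \<Rightarrow>\<^sub>L (complex ^ 'n)" is "\<lambda>v. \<i> *s v"
  by (rule linear_conv_bounded_linear[THEN iffD1], rule linearI)
     (simp_all add: vec_eq_iff algebra_simps)

definition Sym2 :: "((complex ^ 'n) \<Rightarrow>\<^sub>L (complex ^ 'n)) set" where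
  "Sym2 = {A. \<forall>x y. blinfun_apply A x \<bullet> y = x \<bullet> blinfun_apply A y}"

definition LAG :: "(complex ^ 'n) set set" where
  "LAG = {W. subspace W \<and> dim W = CARD('n) \<and> blinfun_apply J ` W = W\<^sup>\<bottom>}"

definition P_LAG :: "((complex ^ 'n) \<Rightarrow>\<^sub>L (complex ^ 'n)) set" where
  "P_LAG = {A \<in> Sym2. \<forall>W\<in>LAG. 0 \<le> trace_on A W}"


section \<open>The operator\<close>

definition mu :: "(complex ^ 'n) \<Rightarrow>\<^sub>L (complex ^ 'n) \<Rightarrow> real" where
  "mu A = trace_on A UNIV / 2"

definition skew_part :: "(complex ^ 'n) \<Rightarrow>\<^sub>L (complex ^ 'n) \<Rightarrow> (complex ^ 'n) \<Rightarrow>\<^sub>L (complex ^ 'n)" where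
  "skew_part A = (1/2) *\<^sub>R (A + (J o\<^sub>L A o\<^sub>L J))"

(* The 2n eigenvalues of the skew part are the l j and the - l j, listed with multiplicity:
   each real t occurs in this list as often as the dimension of its eigenspace.  (The skew part
   is symmetric, so algebraic and geometric multiplicities agree.)  This determines l up to
   a permutation of the indices. *)
definition is_skew_eigenvalues :: "(complex ^ 'n) \<Rightarrow>\<^sub>L (complex ^ 'n) \<Rightarrow> ('n \<Rightarrow> real) \<Rightarrow> bool" where
  "is_skew_eigenvalues A l \<longleftrightarrow> (\<forall>j. 0 \<le> l j) \<and>
     (\<forall>t. dim {x. blinfun_apply (skew_part A) x = t *\<^sub>R x} =
            card {j. l j = t} + card {j. - l j = t})"

(* Some enumeration of the l j; it exists by skew_eigenvalues_exist. *)
definition lam :: "(complex ^ 'n) \<Rightarrow>\<^sub>L (complex ^ 'n) \<Rightarrow> 'n \<Rightarrow> real" where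
  "lam A = (SOME l. is_skew_eigenvalues A l)"

definition sign_choices :: "('n \<Rightarrow> real) set" where
  "sign_choices = (UNIV \<rightarrow> {-1, 1})"

definition Lambda :: "('n \<Rightarrow> real) \<Rightarrow> (complex ^ 'n) \<Rightarrow>\<^sub>L (complex ^ 'n) \<Rightarrow> real" where
  "Lambda s A = mu A + (\<Sum>j\<in>UNIV. s j * lam A j)"

definition M_Lag :: "(complex ^ 'n) \<Rightarrow>\<^sub>L (complex ^ 'n) \<Rightarrow> real" where
  "M_Lag A = (\<Prod>s\<in>sign_choices. Lambda s A)"


section \<open>Garding cones\<close>

(* For p hyperbolic in the direction e the roots of t \<mapsto> p (t e + A) are all real. *)
definition garding_eigenvalues :: "('v::real_vector \<Rightarrow> real) \<Rightarrow> 'v \<Rightarrow> 'v \<Rightarrow> real set" where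
  "garding_eigenvalues p e A = {- t | t. p (t *\<^sub>R e + A) = 0}"

definition closed_garding_cone :: "'v::real_vector set \<Rightarrow> ('v \<Rightarrow> real) \<Rightarrow> 'v \<Rightarrow> 'v set" where
  "closed_garding_cone V p e = {A \<in> V. \<forall>r\<in>garding_eigenvalues p e A. 0 \<le> r}"


section \<open>The eigenvalues of the skew part exist\<close>

lemma J_J [simp]: "blinfun_apply J (blinfun_apply J x) = - x"
  by transfer (simp add: vec_eq_iff flip: mult.assoc)

lemma J_inner: "blinfun_apply J x \<bullet> y = - (x \<bullet> blinfun_apply J y)"
  by transfer (simp add: inner_vec_def inner_complex_def sum_negf[symmetric])

lemma J_J_inner: "blinfun_apply J x \<bullet> blinfun_apply J y = x \<bullet> y"
  by (simp add: J_inner)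

lemma J_inner_self: "x \<bullet> blinfun_apply J x = 0"
  using J_inner[of x x] by (simp add: inner_commute)

lemma skew_part_apply:
  "blinfun_apply (skew_part A) x =
     (1/2) *\<^sub>R (blinfun_apply A x + blinfun_apply J (blinfun_apply A (blinfun_apply J x)))"
  by (simp add: skew_part_def blinfun.add_left blinfun.scaleR_left)

lemma skew_part_symmetric:
  assumes "A \<in> Sym2"
  shows "blinfun_apply (skew_part A) x \<bullet> y = x \<bullet> blinfun_apply (skew_part A) y"
proof -
  have sym: "A x \<bullet> y = x \<bullet> A y" for x y using assms by (simp add: Sym2_def)
  have "J (A (J x)) \<bullet> y = - (A (J x) \<bullet> J y)" by (rule J_inner)
  also have "\<dots> = - (J x \<bullet> A (J y))" by (simp only: sym)
  also have "\<dots> = x \<bullet> J (A (J y))" by (simp add: J_inner)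
  finally show ?thesis
    using sym[of x y] by (simp add: skew_part_apply inner_add_left inner_add_right)
qed

lemma skew_part_J:
  "blinfun_apply (skew_part A) (blinfun_apply J x) = - blinfun_apply J (blinfun_apply (skew_part A) x)"
  by (simp add: skew_part_apply blinfun.add_right blinfun.scaleR_right blinfun.minus_right
      scaleR_diff_right)

lemma symmetric_eigenvector_exists:
  fixes K :: "'a::euclidean_space \<Rightarrow>\<^sub>L 'a"
  assumes sym: "\<And>x y. blinfun_apply K x \<bullet> y = x \<bullet> blinfun_apply K y"
    and V: "subspace V" "V \<noteq> {0}" and inv: "\<And>x. x \<in> V \<Longrightarrow> blinfun_apply K x \<in> V"
  obtains v m where "v \<in> V" "norm v = 1" "blinfun_apply K v = m *\<^sub>R v"
    "\<And>w. w \<in> V \<Longrightarrow> norm w = 1 \<Longrightarrow> blinfun_apply K w \<bullet> w \<le> m"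
proof -
  let ?S = "V \<inter> sphere 0 1"
  have cpt: "compact ?S"
    using V(1) by (intro closed_Int_compact closed_subspace) auto
  obtain x where x: "x \<in> V" "x \<noteq> 0" using V subspace_0 by blast
  then have "x /\<^sub>R norm x \<in> ?S" using V(1) by (auto simp: subspace_scale)
  then have ne: "?S \<noteq> {}" by blast
  have "continuous_on ?S (\<lambda>w. K w \<bullet> w)" by (intro continuous_intros)
  from continuous_attains_sup[OF cpt ne this] obtain v where
    v: "v \<in> V" "norm v = 1" and mx: "\<And>w. w \<in> ?S \<Longrightarrow> K w \<bullet> w \<le> K v \<bullet> v"
    by auto
  define m where "m = K v \<bullet> v"
  have mx': "K w \<bullet> w \<le> m * (w \<bullet> w)" if "w \<in> V" for w
  proof (cases "w = 0")
    case False
    then have "w /\<^sub>R norm w \<in> ?S" using that V(1) by (auto simp: subspace_scale)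
    from mx[OF this] False show ?thesis
      by (simp add: m_def blinfun.scaleR_right dot_square_norm power2_eq_square field_simps)
  qed simp
  have z: "(m *\<^sub>R v - K v) \<bullet> w = 0" if w: "w \<in> V" for w
  proof -
    define b where "b = (m *\<^sub>R v - K v) \<bullet> w"
    define c where "c = m * (w \<bullet> w) - K w \<bullet> w"
    have vv: "v \<bullet> v = 1" using v by (simp add: dot_square_norm)
    have q: "0 \<le> 2 * s * b + s^2 * c" for s
    proof -
      have "v + s *\<^sub>R w \<in> V" using v w V(1) by (simp add: subspace_add subspace_scale)
      from mx'[OF this] show ?thesis
        using sym[of w v] vv
        by (simp add: b_def c_def m_def blinfun.add_right blinfun.scaleR_right inner_add_left
            inner_add_right inner_diff_left inner_commute power2_eq_square algebra_simps)
    qed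
    have c0: "0 \<le> c" using mx'[OF w] by (simp add: c_def)
    define s where "s = - b / (c + 1)"
    have b: "b = - (s * (c + 1))" using c0 by (simp add: s_def)
    have "0 \<le> - (s^2 * (c + 2))"
      using q[of s] by (simp add: b power2_eq_square algebra_simps)
    then have "s^2 \<le> 0" using c0 by (simp add: mult_le_0_iff)
    then have "b = 0" by (simp add: b)
    then show ?thesis by (simp add: b_def)
  qed
  have "m *\<^sub>R v - K v \<in> V" using v inv V(1) by (simp add: subspace_diff subspace_scale)
  from z[OF this] have e: "K v = m *\<^sub>R v" by simp
  show ?thesis
    by (rule that[OF v e]) (use mx in \<open>auto simp: m_def\<close>)
qed

lemma skew_eigenbasis_exists:
  fixes A :: "(complex ^ 'n) \<Rightarrow>\<^sub>L (complex ^ 'n)"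
  assumes A: "A \<in> Sym2"
  shows "\<exists>(e :: 'n \<Rightarrow> complex ^ 'n) l. \<forall>i\<in>F. 0 \<le> l i \<and>
      blinfun_apply (skew_part A) (e i) = l i *\<^sub>R e i \<and>
      (\<forall>j\<in>F. e i \<bullet> e j = (if i = j then 1 else 0) \<and> e i \<bullet> blinfun_apply J (e j) = 0)"
proof (induction F rule: finite_induct[OF finite])
  case 1
  then show ?case by simp
next
  case (2 k F)
  let ?K = "skew_part A"
  from 2(3) obtain e :: "'n \<Rightarrow> complex ^ 'n" and l where
    el: "\<forall>i\<in>F. 0 \<le> l i \<and> ?K (e i) = l i *\<^sub>R e i \<and>
      (\<forall>j\<in>F. e i \<bullet> e j = (if i = j then 1 else 0) \<and> e i \<bullet> J (e j) = 0)"
    by blast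
  then have l: "\<And>i. i \<in> F \<Longrightarrow> 0 \<le> l i" and ev: "\<And>i. i \<in> F \<Longrightarrow> ?K (e i) = l i *\<^sub>R e i"
    and ee: "\<And>i j. i \<in> F \<Longrightarrow> j \<in> F \<Longrightarrow> e i \<bullet> e j = (if i = j then 1 else 0)"
    and eJ: "\<And>i j. i \<in> F \<Longrightarrow> j \<in> F \<Longrightarrow> e i \<bullet> J (e j) = 0"
    by auto
  define S where "S = e ` F \<union> (\<lambda>i. J (e i)) ` F"
  define V where "V = {x. \<forall>i\<in>F. x \<bullet> e i = 0 \<and> x \<bullet> J (e i) = 0}"
  have VS: "subspace V"
    by (auto simp: V_def subspace_def inner_add_left)
  have "F \<noteq> UNIV" using 2 by auto
  then have "card F < CARD('n)"
    by (simp add: psubset_card_mono psubset_eq)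
  moreover have "card S \<le> card F + card F"
    unfolding S_def
    by (rule order.trans[OF card_Un_le]) (intro add_mono card_image_le finite)
  moreover have "dim S \<le> card S" by (intro dim_le_card) (auto simp: S_def span_superset)
  ultimately have "dim S < DIM(complex ^ 'n)" by simp
  then obtain x where x: "x \<noteq> 0" "\<And>y. y \<in> span S \<Longrightarrow> orthogonal x y"
    using orthogonal_to_subspace_exists[of S] by metis
  then have "x \<in> V"
    by (auto simp: V_def S_def orthogonal_def span_base)
  then have V0: "V \<noteq> {0}" using x by blast
  have JV: "J x \<in> V" if "x \<in> V" for x
    using that by (auto simp: V_def J_inner)
  have inv: "?K x \<in> V" if "x \<in> V" for x
    using that ev by (auto simp: V_def skew_part_symmetric[OF A] skew_part_J blinfun.scaleR_right)
  obtain v m where v: "v \<in> V" "norm v = 1" "?K v = m *\<^sub>R v"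
    and mx: "\<And>w. w \<in> V \<Longrightarrow> norm w = 1 \<Longrightarrow> ?K w \<bullet> w \<le> m"
    using symmetric_eigenvector_exists[OF skew_part_symmetric[OF A] VS V0 inv] by metis
  have vv: "v \<bullet> v = 1" using v by (simp add: dot_square_norm)
  have "norm (J v) = 1" using vv by (simp add: norm_eq_sqrt_inner J_J_inner)
  from mx[OF JV[OF v(1)] this] have "- m \<le> m"
    using vv by (simp add: skew_part_J v(3) blinfun.scaleR_right J_J_inner)
  then have m: "0 \<le> m" by simp
  have ve: "v \<bullet> e i = 0" "v \<bullet> J (e i) = 0" "e i \<bullet> v = 0" "e i \<bullet> J v = 0" if "i \<in> F" for i
    using v(1) that J_inner[of "e i" v] by (auto simp: V_def inner_commute)
  let ?e = "e(k := v)" and ?l = "l(k := m)"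
  have "\<forall>i\<in>insert k F. 0 \<le> ?l i \<and> ?K (?e i) = ?l i *\<^sub>R ?e i \<and>
      (\<forall>j\<in>insert k F. ?e i \<bullet> ?e j = (if i = j then 1 else 0) \<and> ?e i \<bullet> J (?e j) = 0)"
    using l ev ee eJ ve v(3) vv m J_inner_self[of v] 2(2) by auto
  then show ?case by blast
qed

lemma skew_eigenvalues_exist:
  fixes A :: "(complex ^ 'n) \<Rightarrow>\<^sub>L (complex ^ 'n)"
  assumes A: "A \<in> Sym2"
  shows "\<exists>l. is_skew_eigenvalues A l"
proof -
  let ?K = "skew_part A"
  from skew_eigenbasis_exists[OF A, of UNIV]
  obtain e :: "'n \<Rightarrow> complex ^ 'n" and l where
    l: "\<And>i. 0 \<le> l i" and ev: "\<And>i. ?K (e i) = l i *\<^sub>R e i"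
    and ee: "\<And>i j. e i \<bullet> e j = (if i = j then 1 else 0)" and eJ: "\<And>i j. e i \<bullet> J (e j) = 0"
    by (metis UNIV_I)
  define b where "b = (\<lambda>(p, i). if p then e i else J (e i))"
  define c where "c = (\<lambda>(p, i). if p then l i else - l i)"
  have bb: "b x \<bullet> b y = (if x = y then 1 else 0)" for x y :: "bool \<times> 'n"
    using ee eJ by (cases x; cases y) (auto simp: b_def J_J_inner J_inner)
  have bev: "?K (b x) = c x *\<^sub>R b x" for x
    using ev by (cases x) (auto simp: b_def c_def skew_part_J blinfun.scaleR_right)
  have inj: "inj b"
  proof (rule injI)
    fix x y assume "b x = b y"
    then show "x = y" using bb[of x y] bb[of x x] by (auto split: if_splits)
  qed
  have indep: "independent (range b)"
  proof (rule pairwise_orthogonal_independent)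
    show "pairwise orthogonal (range b)"
      by (auto simp: pairwise_def orthogonal_def bb)
    show "0 \<notin> range b"
    proof
      assume "0 \<in> range b"
      then obtain x where "b x = 0" by (metis rangeE)
      then show False using bb[of x x] by simp
    qed
  qed
  have "card (range b) = DIM(complex ^ 'n)"
    using inj by (simp add: card_image card_UNIV_bool)
  then have "UNIV \<subseteq> span (range b)"
    using indep by (intro card_ge_dim_independent) auto
  then have onb: "orthonormal_basis_of (range b) UNIV"
    using bb by (auto simp: orthonormal_basis_of_def pairwise_def orthogonal_def norm_eq_sqrt_inner)
  have expand: "x = (\<Sum>i\<in>UNIV. (x \<bullet> b i) *\<^sub>R b i)" for x
    using orthonormal_basis_of_expand[OF onb, of x] inj by (simp add: sum.reindex)
  have "dim {x. ?K x = t *\<^sub>R x} = card {j. l j = t} + card {j. - l j = t}" for t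
  proof -
    let ?E = "{x. ?K x = t *\<^sub>R x}" and ?I = "{i. c i = t}"
    have sub: "b ` ?I \<subseteq> ?E" using bev by auto
    have "?E \<subseteq> span (b ` ?I)"
    proof
      fix x assume "x \<in> ?E"
      then have tc: "t * (x \<bullet> b i) = c i * (x \<bullet> b i)" for i
        using skew_part_symmetric[OF A, of x "b i"] by (simp add: bev)
      have "x \<bullet> b i = 0" if "c i \<noteq> t" for i using tc[of i] that by simp
      then have "(\<Sum>i\<in>UNIV. (x \<bullet> b i) *\<^sub>R b i) = (\<Sum>i\<in>?I. (x \<bullet> b i) *\<^sub>R b i)"
        by (intro sum.mono_neutral_right) auto
      then have eq: "(\<Sum>i\<in>?I. (x \<bullet> b i) *\<^sub>R b i) = x" using expand[of x] by (metis (no_types, lifting))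
      have "(\<Sum>i\<in>?I. (x \<bullet> b i) *\<^sub>R b i) \<in> span (b ` ?I)"
        by (intro span_sum span_scale span_base imageI)
      then show "x \<in> span (b ` ?I)" by (simp only: eq)
    qed
    then have "dim ?E = card (b ` ?I)"
      using sub independent_mono[OF indep, of "b ` ?I"] by (intro dim_unique) auto
    also have "\<dots> = card ?I" using inj by (intro card_image) (auto intro: inj_on_subset)
    also have "?I = Pair True ` {j. l j = t} \<union> Pair False ` {j. - l j = t}"
      by (auto simp: c_def split: if_splits)
    also have "card \<dots> = card {j. l j = t} + card {j. - l j = t}"
      by (subst card_Un_disjoint) (auto simp: card_image inj_on_def)
    finally show ?thesis .
  qed
  then show ?thesis using l by (auto simp: is_skew_eigenvalues_def)
qed

lemma is_skew_eigenvalues_lam: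
  assumes "A \<in> Sym2"
  shows "is_skew_eigenvalues A (lam A)"
  unfolding lam_def by (rule someI_ex[OF skew_eigenvalues_exist[OF assms]])


section \<open>The Garding eigenvalues of the operator\<close>

lemma mu_shift:
  fixes A :: "(complex ^ 'n) \<Rightarrow>\<^sub>L (complex ^ 'n)"
  shows "mu (t *\<^sub>R ((1 / real CARD('n)) *\<^sub>R id_blinfun) + A) = t + mu A"
proof -
  have "(\<Sum>b\<in>(Basis :: (complex ^ 'n) set). b \<bullet> b) = 2 * real CARD('n)"
    by simp
  then show ?thesis
    by (simp add: mu_def trace_on_UNIV blinfun.add_left blinfun.scaleR_left inner_add_left
        sum.distrib flip: sum_distrib_left sum_divide_distrib)
qed

lemma skew_part_shift: "skew_part (r *\<^sub>R id_blinfun + A) = skew_part A"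
  by (rule blinfun_eqI) (simp add: skew_part_apply blinfun.add_left blinfun.scaleR_left
      blinfun.add_right blinfun.scaleR_right)

lemma M_Lag_shift:
  fixes A :: "(complex ^ 'n) \<Rightarrow>\<^sub>L (complex ^ 'n)"
  shows "M_Lag (t *\<^sub>R ((1 / real CARD('n)) *\<^sub>R id_blinfun) + A) =
    (\<Prod>s\<in>sign_choices. t + Lambda s A)"
  unfolding M_Lag_def Lambda_def mu_shift
  by (simp add: lam_def is_skew_eigenvalues_def skew_part_shift add.assoc)

end

theory Submission
  imports Defs
begin

(* The closed Garding cone is read off from the factorisation of M_Lag along the direction of the
   identity, and the smallest Lambda is mu - sum of the l j.  For a Lagrangian W the spaces W and JW
   are orthogonal complements, so tr (A|W) = mu + tr (K|W) with K the skew part.  In a unitary frame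
   e j with K (e j) = l j e j and K (J e j) = - l j J e j, Bessel's inequality for an orthonormal
   basis of W gives tr (K|W) >= - sum of the l j, with equality for W spanned by the J e j. *)

section \<open>Orthonormal families\<close>

lemma orthonormal_family_inj:
  fixes f :: "'i \<Rightarrow> 'a::euclidean_space"
  assumes "\<And>i j. f i \<bullet> f j = (if i = j then 1 else 0)"
  shows "inj f"
proof (rule injI)
  fix i j assume "f i = f j"
  then show "i = j" using assms[of i j] assms[of i i] by (auto split: if_splits)
qed

lemma orthonormal_family_basis_of_span:
  fixes f :: "'i \<Rightarrow> 'a::euclidean_space"
  assumes "\<And>i j. f i \<bullet> f j = (if i = j then 1 else 0)"
  shows "orthonormal_basis_of (range f) (span (range f))"
  using assms
  by (auto simp: orthonormal_basis_of_def pairwise_def orthogonal_def norm_eq_sqrt_inner)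

lemma orthonormal_family_basis_of_UNIV:
  fixes f :: "'i::finite \<Rightarrow> 'a::euclidean_space"
  assumes "\<And>i j. f i \<bullet> f j = (if i = j then 1 else 0)" and "CARD('i) = DIM('a)"
  shows "orthonormal_basis_of (range f) UNIV"
proof -
  note B = orthonormal_family_basis_of_span[of f, OF assms(1)]
  have "card (range f) = DIM('a)"
    using orthonormal_family_inj[of f] assms by (simp add: card_image)
  then have "UNIV \<subseteq> span (range f)"
    using orthonormal_basis_of_finite(2)[OF B] by (intro card_ge_dim_independent) auto
  then show ?thesis using B by (simp add: top.extremum_unique)
qed

lemma orthonormal_family_expand:
  fixes f :: "'i::finite \<Rightarrow> 'a::euclidean_space"
  assumes "\<And>i j. f i \<bullet> f j = (if i = j then 1 else 0)" and "x \<in> span (range f)"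
  shows "(\<Sum>i\<in>UNIV. (x \<bullet> f i) *\<^sub>R f i) = x"
  using orthonormal_basis_of_expand[OF orthonormal_family_basis_of_span[OF assms(1)] assms(2)]
    orthonormal_family_inj[OF assms(1)]
  by (simp add: sum.reindex)

text \<open>The orthogonal projection \<open>p\<close> of \<open>x\<close> onto the span of
  \<open>f\<close> satisfies \<open>p \<bullet> p = x \<bullet> p\<close>, both being the sum of
  squares, so nonnegativity of the squared norm of \<open>x - p\<close> gives the bound.\<close>

lemma bessel_inequality:
  fixes f :: "'i::finite \<Rightarrow> 'a::euclidean_space"
  assumes "\<And>i j. f i \<bullet> f j = (if i = j then 1 else 0)"
  shows "(\<Sum>i\<in>UNIV. (x \<bullet> f i)\<^sup>2) \<le> x \<bullet> x"
proof -
  define p where "p = (\<Sum>i\<in>UNIV. (x \<bullet> f i) *\<^sub>R f i)"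
  have xp: "x \<bullet> p = (\<Sum>i\<in>UNIV. (x \<bullet> f i)\<^sup>2)"
    by (simp add: p_def inner_sum_right power2_eq_square)
  have pf: "p \<bullet> f j = x \<bullet> f j" for j
    by (simp add: p_def inner_sum_left assms if_distrib cong: if_cong)
  have "p \<bullet> p = p \<bullet> (\<Sum>i\<in>UNIV. (x \<bullet> f i) *\<^sub>R f i)" by (simp add: p_def)
  also have "\<dots> = x \<bullet> p" by (simp add: inner_sum_right pf xp power2_eq_square)
  finally have "p \<bullet> p = x \<bullet> p" .
  moreover have "0 \<le> (x - p) \<bullet> (x - p)" by simp
  ultimately show ?thesis
    by (simp add: inner_diff_left inner_diff_right inner_commute flip: xp)
qed

text \<open>By symmetry of \<open>K\<close>, an eigenvector for \<open>t\<close> has zero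
  coefficient along every \<open>f i\<close> with \<open>c i \<noteq> t\<close>. The remaining
  \<open>f i\<close> therefore form a basis of the eigenspace, so multiplicities can be counted on
  indices.\<close>

lemma dim_eigenspace_orthonormal_eigenbasis:
  fixes f :: "'i::finite \<Rightarrow> 'a::euclidean_space" and K :: "'a \<Rightarrow>\<^sub>L 'a"
  assumes orth: "\<And>i j. f i \<bullet> f j = (if i = j then 1 else 0)" and "CARD('i) = DIM('a)"
    and sym: "\<And>x y. blinfun_apply K x \<bullet> y = x \<bullet> blinfun_apply K y"
    and ev: "\<And>i. blinfun_apply K (f i) = c i *\<^sub>R f i"
  shows "dim {x. blinfun_apply K x = t *\<^sub>R x} = card {i. c i = t}"
proof -
  let ?E = "{x. K x = t *\<^sub>R x}" and ?I = "{i. c i = t}"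
  have onb: "orthonormal_basis_of (range f) UNIV"
    by (rule orthonormal_family_basis_of_UNIV) (use assms in auto)
  then have "independent (f ` ?I)"
    using orthonormal_basis_of_finite(2) independent_mono by blast
  moreover have "f ` ?I \<subseteq> ?E" using ev by auto
  moreover have "?E \<subseteq> span (f ` ?I)"
  proof
    fix x assume "x \<in> ?E"
    then have tc: "t * (x \<bullet> f i) = c i * (x \<bullet> f i)" for i
      using sym[of x "f i"] by (simp add: ev)
    then have "(\<Sum>i\<in>UNIV. (x \<bullet> f i) *\<^sub>R f i) = (\<Sum>i\<in>?I. (x \<bullet> f i) *\<^sub>R f i)"
      by (intro sum.mono_neutral_right) auto
    also have "\<dots> \<in> span (f ` ?I)" by (intro span_sum span_scale span_base imageI)
    finally show "x \<in> span (f ` ?I)"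
      using orthonormal_family_expand[OF orth, of x] onb by (simp add: orthonormal_basis_of_def)
  qed
  ultimately have "dim ?E = card (f ` ?I)" by (intro dim_unique) auto
  also have "\<dots> = card ?I"
    using orthonormal_family_inj[OF orth] by (intro card_image) (auto intro: inj_on_subset)
  finally show ?thesis .
qed


section \<open>Unitary frames and Lagrangian planes\<close>

text \<open>The two conditions are the real and imaginary parts of Hermitian orthonormality; with n
  members, such a family is a unitary basis.\<close>

definition unitary_frame :: "('n \<Rightarrow> complex ^ 'n) \<Rightarrow> bool" where
  "unitary_frame e \<longleftrightarrow> (\<forall>i j. e i \<bullet> e j = (if i = j then 1 else 0) \<and> e i \<bullet> blinfun_apply J (e j) = 0)"

text \<open>The index type \<open>bool \<times> 'n\<close> has 2n elements, the real dimension, so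
  the lemmas on families of full size apply without enumerating a union.\<close>

definition real_frame :: "('n \<Rightarrow> complex ^ 'n) \<Rightarrow> bool \<times> 'n \<Rightarrow> complex ^ 'n" where
  "real_frame e = (\<lambda>(p, i). if p then e i else blinfun_apply J (e i))"

lemma sum_UNIV_bool_times:
  fixes g :: "bool \<times> 'n::finite \<Rightarrow> 'b::comm_monoid_add"
  shows "sum g UNIV = (\<Sum>i\<in>UNIV. g (True, i)) + (\<Sum>i\<in>UNIV. g (False, i))"
proof -
  have "sum g UNIV = (\<Sum>p\<in>UNIV. \<Sum>i\<in>UNIV. g (p, i))"
    by (simp add: sum.cartesian_product)
  then show ?thesis by (simp add: UNIV_bool add.commute)
qed

lemma unitary_frame_J:
  assumes "unitary_frame e"
  shows "unitary_frame (\<lambda>i. blinfun_apply J (e i))"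
  using assms by (simp add: unitary_frame_def J_J_inner) (simp add: J_inner)

lemma real_frame_orthonormal:
  assumes "unitary_frame e"
  shows "real_frame e x \<bullet> real_frame e y = (if x = y then 1 else 0)"
  using assms by (cases x; cases y) (auto simp: real_frame_def unitary_frame_def J_J_inner J_inner)

lemma real_frame_basis:
  fixes e :: "'n \<Rightarrow> complex ^ 'n"
  assumes "unitary_frame e"
  shows "orthonormal_basis_of (range (real_frame e)) UNIV"
  by (rule orthonormal_family_basis_of_UNIV)
    (simp_all add: real_frame_orthonormal[OF assms] card_UNIV_bool)

lemma unitary_frame_expand:
  assumes "unitary_frame e"
  shows "(\<Sum>i\<in>UNIV. (x \<bullet> e i) *\<^sub>R e i) +
    (\<Sum>i\<in>UNIV. (x \<bullet> blinfun_apply J (e i)) *\<^sub>R blinfun_apply J (e i)) = x"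
  using orthonormal_family_expand[OF real_frame_orthonormal[OF assms], of x] real_frame_basis[OF assms]
  by (simp add: orthonormal_basis_of_def sum_UNIV_bool_times real_frame_def)

lemma trace_on_orthonormal_family:
  fixes f :: "'i::finite \<Rightarrow> 'a::euclidean_space"
  assumes "\<And>i j. f i \<bullet> f j = (if i = j then 1 else 0)" and "span (range f) = W"
  shows "trace_on A W = (\<Sum>i\<in>UNIV. blinfun_apply A (f i) \<bullet> f i)"
  using trace_on_eq[OF orthonormal_family_basis_of_span[OF assms(1)], of A]
    orthonormal_family_inj[OF assms(1)] assms(2)
  by (simp add: sum.reindex)

text \<open>The full trace is computed in the real frame, pairing \<open>e i\<close> with
  \<open>J (e i)\<close>. The factor 1/2 stays inside the sum so that it can be combined termwise
  with the skew part.\<close>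

lemma mu_unitary_frame:
  assumes e: "unitary_frame e"
  shows "mu A = (\<Sum>i\<in>UNIV. (blinfun_apply A (e i) \<bullet> e i +
    blinfun_apply A (blinfun_apply J (e i)) \<bullet> blinfun_apply J (e i)) / 2)"
proof -
  have "trace_on A UNIV = (\<Sum>x\<in>UNIV. A (real_frame e x) \<bullet> real_frame e x)"
    using real_frame_basis[OF e]
    by (intro trace_on_orthonormal_family)
      (simp_all add: real_frame_orthonormal[OF e] orthonormal_basis_of_def)
  then show ?thesis
    by (simp add: mu_def sum_UNIV_bool_times real_frame_def sum.distrib add_divide_distrib
        sum_divide_distrib)
qed

text \<open>For each \<open>e i\<close> the skew part gives half the difference of the values of
  \<open>A\<close> at \<open>e i\<close> and \<open>J (e i)\<close>, and \<open>mu A\<close> gives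
  half their sum; together they leave the value at \<open>e i\<close>.\<close>

lemma trace_on_unitary_frame:
  assumes e: "unitary_frame e" and W: "span (range e) = W"
  shows "trace_on A W = mu A + (\<Sum>i\<in>UNIV. blinfun_apply (skew_part A) (e i) \<bullet> e i)"
proof -
  have "trace_on A W = (\<Sum>i\<in>UNIV. A (e i) \<bullet> e i)"
    by (rule trace_on_orthonormal_family) (use e W in \<open>simp_all add: unitary_frame_def\<close>)
  also have "\<dots> = mu A + (\<Sum>i\<in>UNIV. skew_part A (e i) \<bullet> e i)"
    by (simp add: mu_unitary_frame[OF e] skew_part_apply J_inner inner_add_left field_simps
        flip: sum.distrib)
  finally show ?thesis .
qed

text \<open>An orthonormal basis of \<open>W\<close>, indexed by \<open>'n\<close>, is already
  unitary, because \<open>J\<close> maps \<open>W\<close> into its orthogonal complement. With the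
  converse below, Lagrangian planes are exactly the real spans of unitary frames.\<close>

lemma LAG_unitary_frame:
  fixes W :: "(complex ^ 'n) set"
  assumes "W \<in> LAG"
  obtains e :: "'n \<Rightarrow> complex ^ 'n" where "unitary_frame e" "span (range e) = W"
proof -
  have W: "subspace W" "dim W = CARD('n)" "J ` W = W\<^sup>\<bottom>"
    using assms by (auto simp: LAG_def)
  obtain B where B: "orthonormal_basis_of B W" using orthonormal_basis_of_exists[OF W(1)] .
  then have BW: "span B = W" by (simp add: orthonormal_basis_of_def)
  have "card B = CARD('n)"
    using dim_span_eq_card_independent[OF orthonormal_basis_of_finite(2)[OF B]] W(2) BW by simp
  then obtain e :: "'n \<Rightarrow> complex ^ 'n" where e: "bij_betw e UNIV B"
    using finite_same_card_bij[OF finite orthonormal_basis_of_finite(1)[OF B]] by metis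
  then have eB: "e i \<in> B" for i by (auto simp: bij_betw_def)
  then have eW: "e i \<in> W" for i using BW span_base by blast
  have "e i \<bullet> e j = (if i = j then 1 else 0)" for i j
  proof (cases "i = j")
    case True
    then show ?thesis using eB[of i] B by (simp add: orthonormal_basis_of_def dot_square_norm)
  next
    case False
    then have "e i \<noteq> e j" using e by (auto simp: bij_betw_def inj_def)
    then show ?thesis using False eB[of i] eB[of j] B
      by (auto simp: orthonormal_basis_of_def pairwise_def orthogonal_def)
  qed
  moreover have "e i \<bullet> J (e j) = 0" for i j
  proof -
    have "J (e j) \<in> W\<^sup>\<bottom>" using eW[of j] W(3) by blast
    then show ?thesis using eW[of i] by (auto simp: orthogonal_comp_def orthogonal_def inner_commute)
  qed
  moreover have "span (range e) = W" using e BW by (simp add: bij_betw_def)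
  ultimately show ?thesis by (intro that[of e]) (simp_all add: unitary_frame_def)
qed

lemma span_unitary_frame_LAG:
  fixes e :: "'n \<Rightarrow> complex ^ 'n"
  assumes e: "unitary_frame e"
  shows "span (range e) \<in> LAG"
proof -
  have orth: "e i \<bullet> e j = (if i = j then 1 else 0)" "e i \<bullet> J (e j) = 0" for i j
    using e by (simp_all add: unitary_frame_def)
  have "dim (span (range e)) = card (range e)"
    using orthonormal_basis_of_finite(2)[OF orthonormal_family_basis_of_span[OF orth(1)]]
    by (simp add: dim_eq_card_independent)
  then have "dim (span (range e)) = CARD('n)"
    using orthonormal_family_inj[OF orth(1)] by (simp add: card_image)
  moreover have "J ` span (range e) = (span (range e))\<^sup>\<bottom>"
  proof
    have "J ` span (range e) = span (J ` range e)"
      by (simp add: linear_span_image blinfun.bounded_linear_right bounded_linear.linear)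
    moreover have "J (e j) \<in> (span (range e))\<^sup>\<bottom>" for j
    proof -
      have "orthogonal (J (e j)) x" if "x \<in> span (range e)" for x
        by (rule orthogonal_to_span[OF that]) (auto simp: orthogonal_def orth inner_commute)
      then show ?thesis by (auto simp: orthogonal_comp_def orthogonal_commute)
    qed
    ultimately show "J ` span (range e) \<subseteq> (span (range e))\<^sup>\<bottom>"
      by (simp add: image_subset_iff span_minimal subspace_orthogonal_comp)
  next
    show "(span (range e))\<^sup>\<bottom> \<subseteq> J ` span (range e)"
    proof
      fix x assume "x \<in> (span (range e))\<^sup>\<bottom>"
      then have "x \<bullet> e i = 0" for i
        by (auto simp: orthogonal_comp_def orthogonal_def inner_commute span_base)
      \<comment> \<open>In the real frame expansion of \<open>x\<close> the \<open>e i\<close>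
        coefficients vanish, so only the \<open>J (e i)\<close> terms survive.\<close>
      then have "x = (\<Sum>i\<in>UNIV. (x \<bullet> J (e i)) *\<^sub>R J (e i))"
        using unitary_frame_expand[OF e, of x] by simp
      also have "\<dots> = J (\<Sum>i\<in>UNIV. (x \<bullet> J (e i)) *\<^sub>R e i)"
        by (simp add: blinfun.sum_right blinfun.scaleR_right)
      finally show "x \<in> J ` span (range e)"
        by (rule image_eqI) (intro span_sum span_scale span_base rangeI)
    qed
  qed
  ultimately show ?thesis by (simp add: LAG_def)
qed


section \<open>The spectrum of the skew part\<close>

(* For t > 0 the eigenspace dimension counts exactly the indices j with l j = t, so it determines
   the sum of the l j. *)
lemma sum_skew_eigenvalues_unique:
  fixes l m :: "'n::finite \<Rightarrow> real"
  assumes l: "is_skew_eigenvalues A l" and m: "is_skew_eigenvalues A m"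
  shows "(\<Sum>j\<in>UNIV. l j) = (\<Sum>j\<in>UNIV. m j)"
proof -
  have card_eq: "card {j. l j = t} = card {j. m j = t}" if "0 < t" for t
  proof -
    have "dim {x. skew_part A x = t *\<^sub>R x} = card {j. k j = t}"
      if k: "is_skew_eigenvalues A k" for k
    proof -
      have "- k j \<noteq> t" for j
      proof -
        have "0 \<le> k j" using k by (simp add: is_skew_eigenvalues_def)
        then show ?thesis using \<open>0 < t\<close> by linarith
      qed
      then have "{j. - k j = t} = {}" by blast
      then show ?thesis using k by (simp add: is_skew_eigenvalues_def)
    qed
    then show ?thesis using l m by metis
  qed
  \<comment> \<open>A common index set for both sums: a value attained by only one of the families
    has an empty fibre in the other and contributes zero there.\<close>
  define T where "T = range l \<union> range m"
  have *: "(\<Sum>j\<in>UNIV. k j) = (\<Sum>t\<in>T. real (card {j. k j = t}) * t)" if "range k \<subseteq> T" for k :: "'n \<Rightarrow> real"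
  proof -
    have "(\<Sum>j\<in>UNIV. k j) = (\<Sum>t\<in>T. \<Sum>j\<in>{j\<in>UNIV. k j = t}. k j)"
      by (rule sum.group[symmetric]) (use that in \<open>auto simp: T_def\<close>)
    then show ?thesis by simp
  qed
  have "real (card {j. l j = t}) * t = real (card {j. m j = t}) * t" if "t \<in> T" for t
  \<comment> \<open>The multiplicities at zero need no comparison, since the factor \<open>t\<close>
    kills that term.\<close>
  proof (cases "t = 0")
    case False
    then have "0 < t" using that l m by (auto simp: T_def is_skew_eigenvalues_def order_less_le)
    then show ?thesis by (simp add: card_eq)
  qed simp
  then have "(\<Sum>t\<in>T. real (card {j. l j = t}) * t) = (\<Sum>t\<in>T. real (card {j. m j = t}) * t)"
    by (rule sum.cong[OF refl])
  then show ?thesis using *[of l] *[of m] by (simp add: T_def)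
qed

text \<open>\<open>lam A\<close> is an arbitrary choice and need not match the eigenvalues of the
  frame index by index. Equality of the sums is enough, as the extremal trace depends only on the
  sum.\<close>

lemma skew_eigenframe:
  fixes A :: "(complex ^ 'n) \<Rightarrow>\<^sub>L (complex ^ 'n)"
  assumes A: "A \<in> Sym2"
  obtains e :: "'n \<Rightarrow> complex ^ 'n" and l where "unitary_frame e" "\<And>i. 0 \<le> l i"
    "\<And>i. blinfun_apply (skew_part A) (e i) = l i *\<^sub>R e i"
    "(\<Sum>j\<in>UNIV. l j) = (\<Sum>j\<in>UNIV. lam A j)"
proof -
  from skew_eigenbasis_exists[OF A, of UNIV]
  obtain e :: "'n \<Rightarrow> complex ^ 'n" and l where
    l: "\<And>i. 0 \<le> l i" and ev: "\<And>i. skew_part A (e i) = l i *\<^sub>R e i"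
    and e: "unitary_frame e"
    unfolding unitary_frame_def by (metis UNIV_I)
  \<comment> \<open>Eigenvalues along the real frame: \<open>skew_part A\<close> anticommutes with
    \<open>J\<close>, so \<open>J (e i)\<close> belongs to \<open>- l i\<close>.\<close>
  define c where "c = (\<lambda>(p, i). if p then l i else - l i)"
  have "dim {x. skew_part A x = t *\<^sub>R x} = card {j. l j = t} + card {j. - l j = t}" for t
  proof -
    have "skew_part A (real_frame e x) = c x *\<^sub>R real_frame e x" for x
      by (cases x) (simp add: real_frame_def c_def ev skew_part_J blinfun.scaleR_right)
    then have "dim {x. skew_part A x = t *\<^sub>R x} = card {x. c x = t}"
      by (intro dim_eigenspace_orthonormal_eigenbasis[OF real_frame_orthonormal[OF e]])
        (simp_all add: card_UNIV_bool skew_part_symmetric[OF A])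
    also have "{x. c x = t} = Pair True ` {j. l j = t} \<union> Pair False ` {j. - l j = t}"
      by (auto simp: c_def split: if_splits)
    also have "card \<dots> = card {j. l j = t} + card {j. - l j = t}"
      by (subst card_Un_disjoint) (auto simp: card_image inj_on_def)
    finally show ?thesis .
  qed
  then have "is_skew_eigenvalues A l" using l by (simp add: is_skew_eigenvalues_def)
  from sum_skew_eigenvalues_unique[OF this is_skew_eigenvalues_lam[OF A]] show ?thesis
    using that e l ev by blast
qed

section \<open>The minimal trace over Lagrangian planes\<close>

text \<open>In the eigenframe, the trace of the skew part on \<open>W\<close> splits into a
  nonnegative part, which is dropped, and a negative part. The latter weights each
  \<open>l i\<close> by the squared length of the projection of \<open>J (e i)\<close> onto
  \<open>W\<close>, which is at most 1.\<close>

lemma trace_on_LAG_ge: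
  fixes A :: "(complex ^ 'n) \<Rightarrow>\<^sub>L (complex ^ 'n)"
  assumes A: "A \<in> Sym2" and "W \<in> LAG"
  shows "mu A - (\<Sum>j\<in>UNIV. lam A j) \<le> trace_on A W"
proof -
  let ?K = "skew_part A"
  obtain e :: "'n \<Rightarrow> complex ^ 'n" and l where e: "unitary_frame e" and l: "\<And>i. 0 \<le> l i"
    and ev: "\<And>i. ?K (e i) = l i *\<^sub>R e i" and sum_l: "(\<Sum>j\<in>UNIV. l j) = (\<Sum>j\<in>UNIV. lam A j)"
    using skew_eigenframe[OF A] by blast
  obtain w :: "'n \<Rightarrow> complex ^ 'n" where w: "unitary_frame w" "span (range w) = W"
    using LAG_unitary_frame[OF assms(2)] .
  have quad: "?K x \<bullet> x = (\<Sum>i\<in>UNIV. l i * (x \<bullet> e i)\<^sup>2) - (\<Sum>i\<in>UNIV. l i * (x \<bullet> J (e i))\<^sup>2)" for x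
  proof -
    have "?K x \<bullet> x = ?K x \<bullet> ((\<Sum>i\<in>UNIV. (x \<bullet> e i) *\<^sub>R e i) + (\<Sum>i\<in>UNIV. (x \<bullet> J (e i)) *\<^sub>R J (e i)))"
      by (simp only: unitary_frame_expand[OF e])
    also have "\<dots> = (\<Sum>i\<in>UNIV. (x \<bullet> e i) * (?K x \<bullet> e i)) + (\<Sum>i\<in>UNIV. (x \<bullet> J (e i)) * (?K x \<bullet> J (e i)))"
      by (simp add: inner_add_right inner_sum_right)
    also have "\<dots> = (\<Sum>i\<in>UNIV. l i * (x \<bullet> e i)\<^sup>2) - (\<Sum>i\<in>UNIV. l i * (x \<bullet> J (e i))\<^sup>2)"
      by (simp add: skew_part_symmetric[OF A] ev skew_part_J blinfun.scaleR_right sum_negf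
          power2_eq_square mult_ac)
    finally show ?thesis .
  qed
  \<comment> \<open>Here the frame \<open>w\<close> of \<open>W\<close> is the orthonormal family
    and the fixed unit vector is \<open>J (e i)\<close>; hence the sum runs over \<open>k\<close>,
    and the double sum below has to be swapped.\<close>
  have bessel: "(\<Sum>k\<in>UNIV. (w k \<bullet> J (e i))\<^sup>2) \<le> 1" for i
    using bessel_inequality[of w "J (e i)"] w(1) e
    by (simp add: unitary_frame_def J_J_inner inner_commute)
  have "(\<Sum>k\<in>UNIV. \<Sum>i\<in>UNIV. l i * (w k \<bullet> J (e i))\<^sup>2) = (\<Sum>i\<in>UNIV. l i * (\<Sum>k\<in>UNIV. (w k \<bullet> J (e i))\<^sup>2))"
    by (subst sum.swap) (simp add: sum_distrib_left)
  also have "\<dots> \<le> (\<Sum>i\<in>UNIV. l i)"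
    using mult_left_mono[OF bessel l] by (intro sum_mono) simp
  finally have "(\<Sum>k\<in>UNIV. \<Sum>i\<in>UNIV. l i * (w k \<bullet> J (e i))\<^sup>2) \<le> (\<Sum>i\<in>UNIV. l i)" .
  moreover have "0 \<le> (\<Sum>k\<in>UNIV. \<Sum>i\<in>UNIV. l i * (w k \<bullet> e i)\<^sup>2)"
    using l by (intro sum_nonneg mult_nonneg_nonneg) auto
  ultimately show ?thesis
    by (simp add: trace_on_unitary_frame[OF w] quad sum_subtractf flip: sum_l)
qed

text \<open>The minimising plane is spanned by the \<open>J (e i)\<close>, on which the skew part
  has the eigenvalues \<open>- l i\<close>.\<close>

lemma trace_on_LAG_attains:
  fixes A :: "(complex ^ 'n) \<Rightarrow>\<^sub>L (complex ^ 'n)"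
  assumes A: "A \<in> Sym2"
  obtains W where "W \<in> LAG" "trace_on A W = mu A - (\<Sum>j\<in>UNIV. lam A j)"
proof -
  obtain e :: "'n \<Rightarrow> complex ^ 'n" and l where e: "unitary_frame e" and "\<And>i. 0 \<le> l i"
    and ev: "\<And>i. skew_part A (e i) = l i *\<^sub>R e i"
    and sum_l: "(\<Sum>j\<in>UNIV. l j) = (\<Sum>j\<in>UNIV. lam A j)"
    using skew_eigenframe[OF A] by blast
  note Je = unitary_frame_J[OF e]
  have "trace_on A (span (range (\<lambda>i. J (e i)))) = mu A - (\<Sum>j\<in>UNIV. l j)"
    using e by (simp add: trace_on_unitary_frame[OF Je refl] skew_part_J ev blinfun.scaleR_right
        J_J_inner unitary_frame_def sum_negf)
  then show ?thesis using that[OF span_unitary_frame_LAG[OF Je]] sum_l by simp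
qed

lemma P_LAG_iff:
  "A \<in> P_LAG \<longleftrightarrow> A \<in> Sym2 \<and> (\<Sum>j\<in>UNIV. lam A j) \<le> mu A"
proof (cases "A \<in> Sym2")
  case True
  obtain W where "W \<in> LAG" "trace_on A W = mu A - (\<Sum>j\<in>UNIV. lam A j)"
    by (rule trace_on_LAG_attains[OF True])
  then show ?thesis using trace_on_LAG_ge[OF True] True unfolding P_LAG_def by fastforce
qed (simp add: P_LAG_def)

section \<open>The inequalities on \<open>Lambda\<close> and the Garding eigenvalues\<close>

text \<open>Since every \<open>lam A j\<close> is nonnegative, the all-minus sign choice gives the
  smallest \<open>Lambda\<close>.\<close>

lemma Lambda_nonneg_iff:
  assumes A: "A \<in> Sym2"
  shows "(\<forall>s\<in>sign_choices. 0 \<le> Lambda s A) \<longleftrightarrow> (\<Sum>j\<in>UNIV. lam A j) \<le> mu A"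
proof
  have "(\<lambda>_. -1) \<in> sign_choices" by (simp add: sign_choices_def)
  moreover assume "\<forall>s\<in>sign_choices. 0 \<le> Lambda s A"
  ultimately have "0 \<le> Lambda (\<lambda>_. -1) A" by blast
  then show "(\<Sum>j\<in>UNIV. lam A j) \<le> mu A" by (simp add: Lambda_def sum_negf)
next
  assume le: "(\<Sum>j\<in>UNIV. lam A j) \<le> mu A"
  have "- (\<Sum>j\<in>UNIV. lam A j) \<le> (\<Sum>j\<in>UNIV. s j * lam A j)" if "s \<in> sign_choices" for s
  proof -
    have "- lam A j \<le> s j * lam A j" for j
    proof -
      have "0 \<le> lam A j" using is_skew_eigenvalues_lam[OF A] by (simp add: is_skew_eigenvalues_def)
      moreover have "s j = -1 \<or> s j = 1" using that by (auto simp: sign_choices_def)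
      ultimately show ?thesis by auto
    qed
    then show ?thesis by (simp add: sum_mono flip: sum_negf)
  qed
  then show "\<forall>s\<in>sign_choices. 0 \<le> Lambda s A" using le by (force simp: Lambda_def)
qed

text \<open>Adding t/n times the identity raises \<open>mu\<close> by t and leaves the skew part
  unchanged, so by \<open>M_Lag_shift\<close> the roots in t are the negatives of the
  \<open>Lambda s A\<close>.\<close>

lemma garding_eigenvalues_M_Lag:
  fixes A :: "(complex ^ 'n) \<Rightarrow>\<^sub>L (complex ^ 'n)"
  shows "garding_eigenvalues M_Lag ((1 / real CARD('n)) *\<^sub>R id_blinfun) A =
    (\<lambda>s. Lambda s A) ` sign_choices"
proof -
  \<comment> \<open>Finiteness makes a zero of the product a zero of some factor; an infinite
    product would be 1 by convention. Over the full index type the function space is an extensional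
    product, to which \<open>finite_PiE\<close> applies.\<close>
  have "finite (sign_choices :: ('n \<Rightarrow> real) set)"
    unfolding sign_choices_def PiE_UNIV_domain[symmetric] by (intro finite_PiE) auto
  then have "garding_eigenvalues M_Lag ((1 / real CARD('n)) *\<^sub>R id_blinfun) A =
      {- t | t. \<exists>s\<in>sign_choices. t + Lambda s A = 0}"
    unfolding garding_eigenvalues_def M_Lag_shift by simp
  also have "\<dots> = (\<lambda>s. Lambda s A) ` sign_choices"
  proof (intro equalityI subsetI)
    fix r assume "r \<in> (\<lambda>s. Lambda s A) ` sign_choices"
    then obtain s where "s \<in> sign_choices" "r = Lambda s A" by blast
    then have "r = - (- r) \<and> (\<exists>s\<in>sign_choices. - r + Lambda s A = 0)" by force
    then show "r \<in> {- t | t. \<exists>s\<in>sign_choices. t + Lambda s A = 0}" by blast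
  next
    fix r assume "r \<in> {- t | t. \<exists>s\<in>sign_choices. t + Lambda s A = 0}"
    then obtain s where "s \<in> sign_choices" "Lambda s A = r"
      by (auto simp: add_eq_0_iff)
    then show "r \<in> (\<lambda>s. Lambda s A) ` sign_choices" by blast
  qed
  finally show ?thesis .
qed

theorem proposition5p5:
  shows "(P_LAG :: ((complex ^ 'n) \<Rightarrow>\<^sub>L (complex ^ 'n)) set) =
           closed_garding_cone Sym2 M_Lag ((1 / real CARD('n)) *\<^sub>R id_blinfun)
       \<and> closed_garding_cone Sym2 M_Lag ((1 / real CARD('n)) *\<^sub>R id_blinfun) =
           {A :: (complex ^ 'n) \<Rightarrow>\<^sub>L (complex ^ 'n). A \<in> Sym2 \<and> (\<forall>s\<in>sign_choices. 0 \<le> Lambda s A)}"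
proof -
  have cone: "closed_garding_cone Sym2 M_Lag ((1 / real CARD('n)) *\<^sub>R id_blinfun) =
      {A :: (complex ^ 'n) \<Rightarrow>\<^sub>L (complex ^ 'n). A \<in> Sym2 \<and> (\<forall>s\<in>sign_choices. 0 \<le> Lambda s A)}"
    by (auto simp: closed_garding_cone_def garding_eigenvalues_M_Lag)
  \<comment> \<open>On \<open>Sym2\<close>, membership in \<open>P_LAG\<close> and the sign
    inequalities both reduce to the sum of the \<open>lam A j\<close> being at most
    \<open>mu A\<close>.\<close>
  show ?thesis unfolding cone using P_LAG_iff Lambda_nonneg_iff by blast
qed

end
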